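(* Let $r\ge 2$ be an integer and let $n=R_r(3r,3r)-1$. Then there is a red/blue edge-coloring of the Kneser graph $\mathrm{KG}(n,r)$ that contains no red induced $\mathrm{KG}(3r,r)$ and no blue triangle. Consequently, the smallest $N\ge 3r$ such that every red/blue edge-coloring of $\mathrm{KG}(N,r)$ contains a red induced $\mathrm{KG}(3r,r)$ or a blue triangle satisfies $N\ge R_r(3r,3r)$.
   Context: The Kneser graph $\mathrm{KG}(n,r)$ has vertex set the $r$-element subsets of $[n]=\{1,\dots,n\}$, with two sets adjacent iff they are disjoint. An induced $\mathrm{KG}(3r,r)$ in $\mathrm{KG}(n,r)$ is the subgraph induced on the vertex set $\binom{S}{r}$ (all $r$-subsets of $S$) for some $S\subseteq[n]$ with $|S|=3r$; it is red if all of its edges are red. A blue triangle is three pairwise adjacent vertices whose three connecting edges are blue. $R_r(s,t)$ denotes the $r$-uniform hypergraph Ramsey number: the minimum $n$ such that in every red/blue coloring of the edges of the complete $r$-uniform hypergraph $K^r_n$ there is a red $s$-clique or a blue $t$-clique (a set of $s$, resp. $t$, vertices all of whose $r$-subsets have that color). *)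

theory Defs
  imports "HOL-Library.Ramsey" "HOL-Library.Extended_Nat"
begin

datatype colour = Red | Blue

text \<open>Colourings are total functions; only the values on the hyperedges (resp. edges) of the
  structure being coloured ever matter.\<close>

definition hypergraph_ramsey :: "nat \<Rightarrow> nat \<Rightarrow> nat \<Rightarrow> nat" where
  "hypergraph_ramsey r s t =
     (LEAST n. \<forall>c :: nat set \<Rightarrow> colour.
        monochromatic {1..n} s r c Red \<or> monochromatic {1..n} t r c Blue)"

lemma hypergraph_ramsey_exists:
  "\<exists>n. \<forall>c :: nat set \<Rightarrow> colour.
      monochromatic {1..n} s r c Red \<or> monochromatic {1..n} t r c Blue"
proof -
  obtain N :: nat where N: "partn_lst {..<N} [s, t] r"
    using ramsey_full by blast
  have "monochromatic {1..N} s r c Red \<or> monochromatic {1..N} t r c Blue"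
    for c :: "nat set \<Rightarrow> colour"
  proof -
    define g :: "nat set \<Rightarrow> nat" where "g X = (if c (Suc ` X) = Red then 0 else 1)" for X
    have "g \<in> nsets {..<N} r \<rightarrow> {..<2}"
      by (auto simp: g_def)
    then obtain i H where i: "i < length [s, t]" and H: "H \<in> nsets {..<N} ([s, t] ! i)"
      and gi: "g ` nsets H r \<subseteq> {i}"
      using partn_lstE[OF N] by (metis length_Cons list.size(3) numeral_2_eq_2)
    have SH: "Suc ` H \<in> nsets {1..N} ([s, t] ! i)"
      using H by (auto simp: nsets_def card_image)
    have "c X = (if i = 0 then Red else Blue)" if "X \<in> nsets (Suc ` H) r" for X
    proof -
      obtain Y where Y: "Y \<in> nsets H r" "X = Suc ` Y"
        using nset_image_obtains[OF \<open>X \<in> nsets (Suc ` H) r\<close>] by auto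
      with gi have "g Y = i" by blast
      then show ?thesis
        using Y(2) by (cases "c X") (auto simp: g_def)
    qed
    then have "c ` nsets (Suc ` H) r \<subseteq> {if i = 0 then Red else Blue}"
      by blast
    with SH i show ?thesis
      unfolding monochromatic_def by (cases i) auto
  qed
  then show ?thesis by blast
qed

definition kneser_vertices :: "nat \<Rightarrow> nat \<Rightarrow> nat set set" where
  "kneser_vertices n r = nsets {1..n} r"

text \<open>The condition \<open>A \<noteq> B\<close> is automatic for \<open>r \<ge> 1\<close>; it only excludes a loop at the empty set
  when \<open>r = 0\<close>.\<close>

definition kneser_edges :: "nat \<Rightarrow> nat \<Rightarrow> nat set set set" where
  "kneser_edges n r =
     {{A, B} | A B. A \<in> kneser_vertices n r \<and> B \<in> kneser_vertices n r \<and> A \<noteq> B \<and> A \<inter> B = {}}"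

definition induced_edges :: "'v set set \<Rightarrow> 'v set \<Rightarrow> 'v set set" where
  "induced_edges E W = {e \<in> E. e \<subseteq> W}"

definition has_red_induced_KG :: "nat \<Rightarrow> nat \<Rightarrow> (nat set set \<Rightarrow> colour) \<Rightarrow> bool" where
  "has_red_induced_KG n r c \<longleftrightarrow>
     (\<exists>S \<in> nsets {1..n} (3 * r). \<forall>e \<in> induced_edges (kneser_edges n r) (nsets S r). c e = Red)"

definition has_blue_triangle :: "nat \<Rightarrow> nat \<Rightarrow> (nat set set \<Rightarrow> colour) \<Rightarrow> bool" where
  "has_blue_triangle n r c \<longleftrightarrow>
     (\<exists>A \<in> kneser_vertices n r. \<exists>B \<in> kneser_vertices n r. \<exists>C \<in> kneser_vertices n r.
        {A, B} \<in> kneser_edges n r \<and> {B, C} \<in> kneser_edges n r \<and> {A, C} \<in> kneser_edges n r \<and>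
        c {A, B} = Blue \<and> c {B, C} = Blue \<and> c {A, C} = Blue)"

text \<open>The smallest \<open>N \<ge> 3 r\<close> with the Ramsey property, as an extended natural number: it is
  \<open>\<infinity>\<close> if there is no such \<open>N\<close>, and a genuine minimum otherwise. Existence is not automatic: for
  \<open>r = 3\<close>, colour \<open>{A, B}\<close> blue iff, up to exchanging \<open>A\<close> and \<open>B\<close>, the elements of \<open>A \<union> B\<close> in
  increasing order lie in \<open>A, A, B, A, B, B\<close>; this has no blue triangle, but every 9-element set
  contains a blue edge.\<close>

definition kneser_ramsey :: "nat \<Rightarrow> enat" where
  "kneser_ramsey r =
     Inf {enat N | N. 3 * r \<le> N \<and> (\<forall>c. has_red_induced_KG N r c \<or> has_blue_triangle N r c)}"

end

theory Submission
  imports Defs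
begin

text \<open>Take a colouring of the \<open>r\<close>-subsets without monochromatic \<open>3r\<close>-clique, and colour an edge of
  the Kneser graph blue iff its ends have different colours. The blue graph is bipartite, so it has
  no triangle. Two \<open>r\<close>-subsets of a \<open>3r\<close>-set always have a common disjoint \<open>r\<close>-subset there, so a
  red induced \<open>KG(3r,r)\<close> would make the \<open>3r\<close>-set monochromatic.\<close>

definition bipartite_colouring :: "(nat set \<Rightarrow> colour) \<Rightarrow> nat set set \<Rightarrow> colour" where
  "bipartite_colouring c e = (if \<exists>A\<in>e. \<exists>B\<in>e. c A \<noteq> c B then Blue else Red)"

lemma bipartite_colouring_pair:
  "bipartite_colouring c {A, B} = (if c A = c B then Red else Blue)"
  by (auto simp: bipartite_colouring_def)

lemma no_blue_triangle_bipartite_colouring: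
  "\<not> has_blue_triangle n r (bipartite_colouring c)"
proof
  assume "has_blue_triangle n r (bipartite_colouring c)"
  then obtain A B C where "c A \<noteq> c B" "c B \<noteq> c C" "c A \<noteq> c C"
    unfolding has_blue_triangle_def bipartite_colouring_pair
    by (metis colour.distinct(1))
  then show False
    by (metis colour.exhaust)
qed

text \<open>\<open>A\<close> and \<open>B\<close> cover at most \<open>2 * r\<close> points of
  \<open>S\<close>, so at least \<open>r\<close> points remain for \<open>C\<close>; they may
  overlap or coincide. This is where the size \<open>3 * r\<close> enters.\<close>

lemma common_disjoint_nset:
  assumes "S \<in> nsets V (3 * r)" "A \<in> nsets S r" "B \<in> nsets S r"
  obtains C where "C \<in> nsets S r" "A \<inter> C = {}" "B \<inter> C = {}"
proof -
  have S: "finite S" "card S = 3 * r" and AB: "A \<subseteq> S" "B \<subseteq> S" "card A = r" "card B = r"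
    using assms by (auto simp: nsets_def)
  have "card (A \<union> B) \<le> 2 * r"
    using card_Un_le[of A B] AB by simp
  moreover have "card (S - (A \<union> B)) = card S - card (A \<union> B)"
    using S AB by (meson card_Diff_subset finite_subset le_sup_iff)
  ultimately have "r \<le> card (S - (A \<union> B))"
    using S by simp
  then obtain C where "C \<subseteq> S - (A \<union> B)" "card C = r" "finite C"
    by (rule obtain_subset_with_card_n)
  then show thesis
    by (intro that[of C]) (auto simp: nsets_def)
qed

lemma red_induced_KG_monochromatic:
  assumes "r \<ge> 1" and red: "has_red_induced_KG n r (bipartite_colouring c)"
  shows "\<exists>k. monochromatic {1..n} (3 * r) r c k"
proof -
  obtain S where S: "S \<in> nsets {1..n} (3 * r)"
    and e: "\<And>e. e \<in> induced_edges (kneser_edges n r) (nsets S r) \<Longrightarrow> bipartite_colouring c e = Red"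
    using red by (auto simp: has_red_induced_KG_def)
  have disj: "c A = c B" if "A \<in> nsets S r" "B \<in> nsets S r" "A \<inter> B = {}" for A B
  proof -
    \<comment> \<open>A nonempty set is not disjoint from itself, hence
      \<open>r \<ge> 1\<close>.\<close>
    have "A \<noteq> B"
      using that \<open>r \<ge> 1\<close> by (auto simp: nsets_def)
    moreover have "A \<in> kneser_vertices n r" "B \<in> kneser_vertices n r"
      using that S by (auto simp: kneser_vertices_def nsets_def)
    ultimately have "{A, B} \<in> induced_edges (kneser_edges n r) (nsets S r)"
      using that unfolding induced_edges_def kneser_edges_def by blast
    from e[OF this] show ?thesis
      by (simp add: bipartite_colouring_pair split: if_splits)
  qed
  \<comment> \<open>For the common disjoint \<open>C\<close>, two red edges give
    \<open>c A = c C = c B\<close>.\<close>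
  have eq: "c A = c B" if "A \<in> nsets S r" "B \<in> nsets S r" for A B
    using common_disjoint_nset[OF S that] disj that by metis
  then have "\<exists>k. c ` nsets S r \<subseteq> {k}"
    by blast
  with S show ?thesis
    by (auto simp: monochromatic_def)
qed

text \<open>Treating every \<open>N\<close> below the Ramsey number, not just its predecessor,
  yields the bound on \<open>kneser_ramsey\<close> without any monotonicity in
  \<open>N\<close>.\<close>

lemma kneser_colouring_below_hypergraph_ramsey:
  assumes "r \<ge> 1" "N < hypergraph_ramsey r (3 * r) (3 * r)"
  shows "\<exists>c. \<not> has_red_induced_KG N r c \<and> \<not> has_blue_triangle N r c"
proof -
  obtain c :: "nat set \<Rightarrow> colour" where
    "\<not> monochromatic {1..N} (3 * r) r c Red" "\<not> monochromatic {1..N} (3 * r) r c Blue"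
    using not_less_Least[OF assms(2)[unfolded hypergraph_ramsey_def]] by blast
  then have "\<not> monochromatic {1..N} (3 * r) r c k" for k
    by (cases k) auto
  then show ?thesis
    using red_induced_KG_monochromatic[OF assms(1)] no_blue_triangle_bipartite_colouring by blast
qed

text \<open>The empty vertex set has no nonempty clique. Positivity ensures that the truncated
  subtraction defining \<open>n\<close> in the theorem really gives a smaller number.\<close>

lemma hypergraph_ramsey_pos:
  assumes "s \<ge> 1" "t \<ge> 1"
  shows "hypergraph_ramsey r s t > 0"
proof (rule ccontr)
  assume "\<not> ?thesis"
  then have "\<forall>c :: nat set \<Rightarrow> colour.
      monochromatic {1..0} s r c Red \<or> monochromatic {1..0} t r c Blue"
    using LeastI_ex[OF hypergraph_ramsey_exists[of s r t]]
    unfolding hypergraph_ramsey_def by simp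
  with assms show False
    by (auto simp: monochromatic_def nsets_def)
qed

theorem theorem1p14:
  fixes r n :: nat
  assumes "r \<ge> 2"
    and "n = hypergraph_ramsey r (3 * r) (3 * r) - 1"
  shows "(\<exists>c. \<not> has_red_induced_KG n r c \<and> \<not> has_blue_triangle n r c) \<and>
         kneser_ramsey r \<ge> enat (hypergraph_ramsey r (3 * r) (3 * r))"
proof
  have r: "r \<ge> 1"
    using assms by simp
  have "n < hypergraph_ramsey r (3 * r) (3 * r)"
    using hypergraph_ramsey_pos[of "3 * r" "3 * r" r] assms by simp
  with r show "\<exists>c. \<not> has_red_induced_KG n r c \<and> \<not> has_blue_triangle n r c"
    by (rule kneser_colouring_below_hypergraph_ramsey)
  have "hypergraph_ramsey r (3 * r) (3 * r) \<le> N"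
    if "\<forall>c. has_red_induced_KG N r c \<or> has_blue_triangle N r c" for N
    using kneser_colouring_below_hypergraph_ramsey[OF r] that by (meson not_le)
  \<comment> \<open>A lower bound on all members bounds the infimum, also when there are none and it
    is \<infinity>.\<close>
  then show "kneser_ramsey r \<ge> enat (hypergraph_ramsey r (3 * r) (3 * r))"
    unfolding kneser_ramsey_def by (intro Inf_greatest) auto
qed

end
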